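(* Let $M,M'$ be $\mathbb O$-bimodules and $f:M\to M'$ real linear. The following are equivalent: (1) $f$ is right para-linear; (2) $B_p(f,x)=0$ for all $p\in\mathbb O$ and all $x\in\operatorname{Re}M$; (3) for every $J\in\mathbb S$, $B_p(f,z)=0$ for all $p\in\mathbb C_J$ and all $z\in\mathbb C_J(M)$; (4) for every $J\in\mathbb S$, $f(zp)=f(z)p$ for all $p\in\mathbb C_J$ and $z\in\mathbb C_J(M)$.
   Context: $\mathbb O$ is the real octonion algebra with basis $e_0=1,\dots,e_7$; $\mathbb S=\{J\in\mathbb O:J^2=-1\}$, $\mathbb C_J=\mathbb R+\mathbb RJ$. An $\mathbb O$-bimodule is a real vector space $M$ with real-bilinear left and right multiplications by $\mathbb O$ (with $1x=x1=x$) whose associators $[p,q,x]=(pq)x-p(qx)$, $[p,x,q]=(px)q-p(xq)$, $[x,p,q]=(xp)q-x(pq)$ satisfy $[p,q,x]=[q,x,p]=[x,p,q]=-[q,p,x]$. Its real part is $\operatorname{Re}M=\{m: pm=mp,\ [p,q,m]=0\ \forall p,q\}$; every $x\in M$ decomposes uniquely as $x=\sum_ie_ix_i$ with $x_i\in\operatorname{Re}M$, and $\operatorname{Re}x:=x_0$. $\mathbb C_J(M)=\operatorname{Re}M\oplus J\operatorname{Re}M$. For real-linear $f$, $B_p(f,x)=f(x)p-f(xp)$, and $f$ is right para-linear if $\operatorname{Re}B_p(f,x)=0$ for all $p\in\mathbb O$, $x\in M$. *)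

theory Defs
  imports "HOL-Analysis.Analysis" "HOL-Library.Numeral_Type"
begin

type_synonym oct = "real ^ 8"

definition oe :: "nat \<Rightarrow> oct" where
  "oe k = axis (of_nat k :: 8) 1"

text \<open>Cyclic multiplication triples (Fano plane, e_i e_(i+1) = e_(i+3), indices mod 7 in 1..7):
  for (a,b,c) in the set, e_a e_b = e_c; reversed order gives the negative.\<close>
definition oct_triples :: "(nat \<times> nat \<times> nat) set" where
  "oct_triples = {(1,2,4),(2,4,1),(4,1,2),
                  (2,3,5),(3,5,2),(5,2,3),
                  (3,4,6),(4,6,3),(6,3,4),
                  (4,5,7),(5,7,4),(7,4,5),
                  (5,6,1),(6,1,5),(1,5,6),
                  (6,7,2),(7,2,6),(2,6,7),
                  (7,1,3),(1,3,7),(3,7,1)}"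

definition osign :: "nat \<Rightarrow> nat \<Rightarrow> real" where
  "osign i j = (if i = 0 \<or> j = 0 then 1 else if i = j then -1
                else if (\<exists>k. (i,j,k) \<in> oct_triples) then 1 else -1)"

definition oidx :: "nat \<Rightarrow> nat \<Rightarrow> nat" where
  "oidx i j = (if i = 0 then j else if j = 0 then i else if i = j then 0
               else (THE k. (i,j,k) \<in> oct_triples \<or> (j,i,k) \<in> oct_triples))"

definition omul :: "oct \<Rightarrow> oct \<Rightarrow> oct" where
  "omul x y = (\<Sum>i<8. \<Sum>j<8. (x $ of_nat i * y $ of_nat j * osign i j) *\<^sub>R oe (oidx i j))"

definition oct_S :: "oct set" where
  "oct_S = {J. omul J J = - oe 0}"

definition oct_CJ :: "oct \<Rightarrow> oct set" where
  "oct_CJ J = {a *\<^sub>R oe 0 + b *\<^sub>R J | a b. True}"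

definition oct_bimodule :: "(oct \<Rightarrow> 'm::real_vector \<Rightarrow> 'm) \<Rightarrow> ('m \<Rightarrow> oct \<Rightarrow> 'm) \<Rightarrow> bool" where
  "oct_bimodule lm rm \<longleftrightarrow>
     (\<forall>p. linear (lm p)) \<and> (\<forall>x. linear (\<lambda>p. lm p x)) \<and>
     (\<forall>p. linear (\<lambda>x. rm x p)) \<and> (\<forall>x. linear (rm x)) \<and>
     (\<forall>x. lm (oe 0) x = x \<and> rm x (oe 0) = x) \<and>
     (\<forall>p q x.
        let a_pqx = lm (omul p q) x - lm p (lm q x);
            a_qxp = rm (lm q x) p - lm q (rm x p);
            a_xpq = rm (rm x p) q - rm x (omul p q);
            a_qpx = lm (omul q p) x - lm q (lm p x)
        in a_pqx = a_qxp \<and> a_qxp = a_xpq \<and> a_xpq = - a_qpx)"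

definition oct_ReM :: "(oct \<Rightarrow> 'm::real_vector \<Rightarrow> 'm) \<Rightarrow> ('m \<Rightarrow> oct \<Rightarrow> 'm) \<Rightarrow> 'm set" where
  "oct_ReM lm rm = {m. (\<forall>p. lm p m = rm m p) \<and> (\<forall>p q. lm (omul p q) m - lm p (lm q m) = 0)}"

text \<open>Re x := x_0, where x = sum_i e_i x_i with x_i in Re M (unique decomposition).\<close>
definition oct_Re :: "(oct \<Rightarrow> 'm::real_vector \<Rightarrow> 'm) \<Rightarrow> ('m \<Rightarrow> oct \<Rightarrow> 'm) \<Rightarrow> 'm \<Rightarrow> 'm" where
  "oct_Re lm rm x = (THE x0. \<exists>xs. (\<forall>i<8. xs i \<in> oct_ReM lm rm) \<and>
                                 x = (\<Sum>i<8. lm (oe i) (xs i)) \<and> x0 = xs 0)"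

definition oct_CJM :: "(oct \<Rightarrow> 'm::real_vector \<Rightarrow> 'm) \<Rightarrow> ('m \<Rightarrow> oct \<Rightarrow> 'm) \<Rightarrow> oct \<Rightarrow> 'm set" where
  "oct_CJM lm rm J = {a + lm J b | a b. a \<in> oct_ReM lm rm \<and> b \<in> oct_ReM lm rm}"

definition oct_B :: "('m \<Rightarrow> oct \<Rightarrow> 'm) \<Rightarrow> ('n \<Rightarrow> oct \<Rightarrow> 'n::real_vector) \<Rightarrow> ('m \<Rightarrow> 'n) \<Rightarrow> oct \<Rightarrow> 'm \<Rightarrow> 'n" where
  "oct_B rm rm' f p x = rm' (f x) p - f (rm x p)"

definition right_para_linear ::
  "('m \<Rightarrow> oct \<Rightarrow> 'm) \<Rightarrow> (oct \<Rightarrow> 'n::real_vector \<Rightarrow> 'n) \<Rightarrow> ('n \<Rightarrow> oct \<Rightarrow> 'n) \<Rightarrow> ('m \<Rightarrow> 'n) \<Rightarrow> bool" where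
  "right_para_linear rm lm' rm' f \<longleftrightarrow> (\<forall>p x. oct_Re lm' rm' (oct_B rm rm' f p x) = 0)"

end

theory Submission
  imports Defs
begin

text \<open>
  Write $L_i, R_i$ for left and right multiplication by $e_i$ on a bimodule. For a line
  $(a,b,c)$ of the Fano plane the operator $T = L_a L_b L_c$ is an involution, and the alternating
  property of the associators forces $(1 + T)(R_a + L_a) = 0$. Taking the three lines through
  one point, this gives $L_1 L_2 \cdots L_7 = -1$, so that the seven operators $-T$ and the
  identity form an elementary abelian group of order 8. The average over this group is a
  projection; its values are nuclear, hence commute with all associators of octonions, and these
  span the imaginary octonions. So it projects onto the real part of the bimodule, and the
  averages over the other seven characters give the decomposition $x = \sum_i e_i x_i$.

  This projection kills all associators. If $f$ is right para-linear and $x$ is real, then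
  $c = f(x)p - f(xp)$ satisfies $\mathrm{Re}(cq) = 0$ for every $q$, whence $c = 0$. Conversely, if
  $f(yp) = f(y)p$ for all real $y$, then $B_p(f, x)$ is a sum of associators
  $[f(x_i), e_i, p]$. Condition (3) only has to be tested on $J = e_i$ because
  $B_p(f, x)$ is linear in $p$.
\<close>

section \<open>Octonion arithmetic\<close>

lemma lessThan_8: "{..<8} = {0, 1, 2, 3, 4, 5, 6, 7 :: nat}"
  by auto

lemma of_nat_8_inj: "inj_on (of_nat :: nat \<Rightarrow> 8) {..<8}"
  by (simp add: lessThan_8 inj_on_def)

lemma of_nat_8_range: "(of_nat :: nat \<Rightarrow> 8) ` {..<8} = UNIV"
  by (rule card_subset_eq) (simp_all add: card_image of_nat_8_inj)

lemma oe_nth: "a < 8 \<Longrightarrow> i < 8 \<Longrightarrow> oe a $ of_nat i = (if i = a then 1 else 0)"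
  using of_nat_8_inj by (auto simp: oe_def axis_def inj_on_def)

lemma oct_expansion: "p = (\<Sum>i<8. (p $ of_nat i) *\<^sub>R oe i)"
proof -
  have "p = (\<Sum>i\<in>UNIV. (p $ i) *\<^sub>R axis i 1)"
    using basis_expansion[of p] by (simp add: scalar_mult_eq_scaleR)
  also have "\<dots> = (\<Sum>i\<in>(of_nat :: nat \<Rightarrow> 8) ` {..<8}. (p $ i) *\<^sub>R axis i 1)"
    by (simp add: of_nat_8_range)
  also have "\<dots> = (\<Sum>i<8. (p $ of_nat i) *\<^sub>R oe i)"
    by (simp add: sum.reindex of_nat_8_inj oe_def)
  finally show ?thesis .
qed

lemma omul_oe:
  assumes "a < 8" "b < 8"
  shows "omul (oe a) (oe b) = osign a b *\<^sub>R oe (oidx a b)"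
proof -
  have "omul (oe a) (oe b) = (\<Sum>i<8. \<Sum>j<8. if j = b then if i = a then osign i j *\<^sub>R oe (oidx i j) else 0 else 0)"
    unfolding omul_def by (intro sum.cong refl) (simp add: assms oe_nth)
  also have "\<dots> = osign a b *\<^sub>R oe (oidx a b)"
    using assms by (simp add: sum.delta)
  finally show ?thesis .
qed

lemma oct_triples_range:
  "(a, b, c) \<in> oct_triples \<Longrightarrow> 1 \<le> a \<and> a < 8 \<and> 1 \<le> b \<and> b < 8 \<and> 1 \<le> c \<and> c < 8 \<and> a \<noteq> b \<and> b \<noteq> c \<and> a \<noteq> c"
  unfolding oct_triples_def by (elim insertE emptyE; simp)

lemma oct_triples_cyclic: "(a, b, c) \<in> oct_triples \<Longrightarrow> (b, c, a) \<in> oct_triples"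
  unfolding oct_triples_def by (elim insertE emptyE; simp)

lemma oct_triples_unique:
  "(a, b, c) \<in> oct_triples \<Longrightarrow> (a, b, d) \<in> oct_triples \<or> (b, a, d) \<in> oct_triples \<longleftrightarrow> d = c"
  unfolding oct_triples_def by (elim insertE emptyE; auto)

lemma oct_triples_asym: "(a, b, c) \<in> oct_triples \<Longrightarrow> (b, a, d) \<notin> oct_triples"
  unfolding oct_triples_def by (elim insertE emptyE; auto)

lemma oct_triples_exhaust:
  assumes "1 \<le> a" "a < 8" "1 \<le> b" "b < 8" "a \<noteq> b"
  obtains c where "(a, b, c) \<in> oct_triples \<or> (b, a, c) \<in> oct_triples"
proof -
  have "a \<in> {1,2,3,4,5,6,7}" "b \<in> {1,2,3,4,5,6,7}" using assms by auto
  then have "\<exists>c. (a, b, c) \<in> oct_triples \<or> (b, a, c) \<in> oct_triples"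
    using \<open>a \<noteq> b\<close> unfolding oct_triples_def by (elim insertE emptyE) simp_all
  with that show thesis by blast
qed

lemma omul_oe_0 [simp]: "a < 8 \<Longrightarrow> omul (oe 0) (oe a) = oe a" "a < 8 \<Longrightarrow> omul (oe a) (oe 0) = oe a"
  by (simp_all add: omul_oe osign_def oidx_def)

lemma omul_oe_self: "1 \<le> a \<Longrightarrow> a < 8 \<Longrightarrow> omul (oe a) (oe a) = - oe 0"
  by (simp add: omul_oe osign_def oidx_def)

lemma omul_oe_triple:
  assumes "(a, b, c) \<in> oct_triples"
  shows "omul (oe a) (oe b) = oe c" "omul (oe b) (oe a) = - oe c"
proof -
  note r = oct_triples_range[OF assms]
  have "oidx a b = c" "oidx b a = c"
    using r oct_triples_unique[OF assms] by (auto simp: oidx_def disj_commute)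
  moreover have "osign a b = 1" "osign b a = -1"
    using r assms oct_triples_asym[OF assms] by (auto simp: osign_def)
  ultimately show "omul (oe a) (oe b) = oe c" "omul (oe b) (oe a) = - oe c"
    using r by (simp_all add: omul_oe)
qed

lemma oct_eqI:
  fixes F G :: "oct \<Rightarrow> 'a::real_vector"
  assumes "linear F" "linear G" "\<And>i. i < 8 \<Longrightarrow> F (oe i) = G (oe i)"
  shows "F p = G p"
proof -
  have "F p = (\<Sum>i<8. (p $ of_nat i) *\<^sub>R F (oe i))"
    using arg_cong[OF oct_expansion[of p], of F] assms(1) by (simp only: linear_sum linear_scale)
  also have "\<dots> = (\<Sum>i<8. (p $ of_nat i) *\<^sub>R G (oe i))"
    by (simp add: assms(3))
  also have "\<dots> = G p"
    using arg_cong[OF oct_expansion[of p], of G] assms(2) by (simp only: linear_sum linear_scale)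
  finally show ?thesis .
qed

lemma linear_omul_left: "linear (\<lambda>p. omul p q)"
  unfolding omul_def
  by (intro linear_compose_sum ballI linearI)
     (simp_all add: algebra_simps flip: scaleR_left_distrib)

lemma linear_omul_right: "linear (omul p)"
  unfolding omul_def
  by (intro linear_compose_sum ballI linearI)
     (simp_all add: algebra_simps flip: scaleR_left_distrib)

lemma oe_mem_S: "1 \<le> i \<Longrightarrow> i < 8 \<Longrightarrow> oe i \<in> oct_S"
  by (simp add: oct_S_def omul_oe_self)

declare One_nat_def [simp del]

lemma oct_bilinear_eqI:
  fixes F G :: "oct \<Rightarrow> oct \<Rightarrow> 'a::real_vector"
  assumes "\<And>q. linear (\<lambda>p. F p q)" "\<And>p. linear (F p)" "\<And>q. linear (\<lambda>p. G p q)" "\<And>p. linear (G p)"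
    and "\<And>i j. i < 8 \<Longrightarrow> j < 8 \<Longrightarrow> F (oe i) (oe j) = G (oe i) (oe j)"
  shows "F p q = G p q"
proof -
  have "F (oe i) q = G (oe i) q" if "i < 8" for i
    using assms(2,4) by (rule oct_eqI) (rule assms(5)[OF that])
  with assms(1,3) show ?thesis
    by (rule oct_eqI[of "\<lambda>p. F p q" "\<lambda>p. G p q"])
qed

lemma oct_basis_cases:
  assumes "i < 8" "j < 8"
  obtains "i = 0" | "j = 0" | "i = j" "1 \<le> i"
    | c where "(i, j, c) \<in> oct_triples" | c where "(j, i, c) \<in> oct_triples"
  using assms oct_triples_exhaust[of i j] by (metis less_one not_le)

definition oassoc :: "oct \<Rightarrow> oct \<Rightarrow> oct \<Rightarrow> oct" where
  "oassoc x y z = omul (omul x y) z - omul x (omul y z)"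

text \<open>For consecutive points (indices modulo 7), $[e_i, e_{i+1}, e_{i+2}] = -2 e_{i+5}$.\<close>

lemma oassoc_basis:
  assumes "1 \<le> f" "f < 8"
  obtains x y z where "oassoc x y z = -2 *\<^sub>R oe f"
proof -
  note found = that
  \<comment> \<open>The four lines give \<open>(e_a e_b) e_c = e_d e_c = -e_f\<close> and
    \<open>e_a (e_b e_c) = e_a e_e = e_f\<close>.\<close>
  have *: thesis if "(a, b, d) \<in> oct_triples" "(c, d, f) \<in> oct_triples" "(b, c, e) \<in> oct_triples"
    "(a, e, f) \<in> oct_triples" for a b c d e
    using that found[of "oe a" "oe b" "oe c"]
    by (simp add: oassoc_def omul_oe_triple linear_neg[OF linear_omul_left] scaleR_2)
  have "f = 6 \<or> f = 7 \<or> f = 1 \<or> f = 2 \<or> f = 3 \<or> f = 4 \<or> f = 5"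
    using assms by auto
  then show thesis
    using *[of 1 2 4 3 5] *[of 2 3 5 4 6] *[of 3 4 6 5 7] *[of 4 5 7 6 1]
      *[of 5 6 1 7 2] *[of 6 7 2 1 3] *[of 7 1 3 2 4]
    by (elim disjE) (simp_all add: oct_triples_def)
qed

section \<open>Octonion bimodules\<close>

locale octonion_bimodule =
  fixes lm :: "oct \<Rightarrow> 'm::real_vector \<Rightarrow> 'm" and rm :: "'m \<Rightarrow> oct \<Rightarrow> 'm"
  assumes bimodule: "oct_bimodule lm rm"
begin

lemma linear_lm: "linear (lm p)" and linear_lm_left: "linear (\<lambda>p. lm p x)"
  and linear_rm: "linear (\<lambda>x. rm x p)" and linear_rm_right: "linear (rm x)"
  using bimodule by (simp_all add: oct_bimodule_def)

lemmas bilinear_simps [simp] =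
  linear_add[OF linear_lm] linear_add[OF linear_lm_left] linear_add[OF linear_rm] linear_add[OF linear_rm_right]
  linear_diff[OF linear_lm] linear_diff[OF linear_lm_left] linear_diff[OF linear_rm] linear_diff[OF linear_rm_right]
  linear_neg[OF linear_lm] linear_neg[OF linear_lm_left] linear_neg[OF linear_rm] linear_neg[OF linear_rm_right]
  linear_scale[OF linear_lm] linear_scale[OF linear_lm_left] linear_scale[OF linear_rm] linear_scale[OF linear_rm_right]
  linear_0[OF linear_lm] linear_0[OF linear_lm_left] linear_0[OF linear_rm] linear_0[OF linear_rm_right]

lemmas bilinear_sum =
  linear_sum[OF linear_lm] linear_sum[OF linear_lm_left] linear_sum[OF linear_rm] linear_sum[OF linear_rm_right]

lemma unit [simp]: "lm (oe 0) x = x" "rm x (oe 0) = x"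
  using bimodule by (simp_all add: oct_bimodule_def)

lemma assoc_left_middle: "lm (omul p q) x - lm p (lm q x) = rm (lm q x) p - lm q (rm x p)"
  and assoc_middle_right: "rm (lm q x) p - lm q (rm x p) = rm (rm x p) q - rm x (omul p q)"
  and assoc_right_swap: "rm (rm x p) q - rm x (omul p q) = - (lm (omul q p) x - lm q (lm p x))"
  using bimodule unfolding oct_bimodule_def Let_def by blast+

lemma assoc_left_right: "lm (omul p q) x - lm p (lm q x) = rm (rm x p) q - rm x (omul p q)"
  using assoc_left_middle assoc_middle_right by metis

lemma assoc_left_swap: "lm (omul p q) x - lm p (lm q x) = - (lm (omul q p) x - lm q (lm p x))"
  using assoc_left_right assoc_right_swap by metis

lemma assoc_left_self: "lm (omul p p) x = lm p (lm p x)"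
proof -
  let ?a = "lm (omul p p) x - lm p (lm p x)"
  have "?a + ?a = 0" using assoc_left_swap[of p p x] by (metis add.right_inverse)
  then have "2 *\<^sub>R ?a = 0" by (simp only: scaleR_2)
  then show ?thesis by simp
qed

lemma assoc_right_self: "rm x (omul p p) = rm (rm x p) p"
  using assoc_left_right[of p p x] by (simp add: assoc_left_self)

lemma assoc_middle_self: "rm (lm p x) p = lm p (rm x p)"
  using assoc_left_middle[of p p x] by (simp add: assoc_left_self)

section \<open>Clifford relations among multiplications by imaginary units\<close>

abbreviation L :: "nat \<Rightarrow> 'm \<Rightarrow> 'm" where "L i \<equiv> lm (oe i)"
abbreviation R :: "nat \<Rightarrow> 'm \<Rightarrow> 'm" where "R i x \<equiv> rm x (oe i)"

lemma L_square: "1 \<le> a \<Longrightarrow> a < 8 \<Longrightarrow> L a (L a x) = - x"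
  using assoc_left_self[of "oe a" x] by (simp add: omul_oe_self)

lemma R_square: "1 \<le> a \<Longrightarrow> a < 8 \<Longrightarrow> R a (R a x) = - x"
  using assoc_right_self[of x "oe a"] by (simp add: omul_oe_self)

lemma L_R_same: "R a (L a x) = L a (R a x)"
  by (rule assoc_middle_self)

text \<open>These are the associator axioms at \<open>p = e_a\<close>, \<open>q = e_b\<close>. In
  the last two, skew symmetry makes the terms with \<open>e_c\<close> cancel.\<close>

lemma triple_relations:
  assumes "(a, b, c) \<in> oct_triples"
  shows "R a (L b x) - L b (R a x) = L c x - L a (L b x)"
    and "R b (R a x) - R c x = L c x - L a (L b x)"
    and "L b (L a x) = - L a (L b x)" and "R b (R a x) = - R a (R b x)"
proof -
  note om = omul_oe_triple[OF assms]
  show "R a (L b x) - L b (R a x) = L c x - L a (L b x)"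
    using assoc_left_middle[of "oe a" "oe b" x] by (simp add: om)
  show *: "R b (R a x) - R c x = L c x - L a (L b x)"
    using assoc_left_right[of "oe a" "oe b" x] by (simp add: om)
  show L: "L b (L a x) = - L a (L b x)"
    using assoc_left_swap[of "oe a" "oe b" x] by (simp add: om eq_neg_iff_add_eq_0 add.commute)
  have "R b (R a x) + R a (R b x) = 0"
    using assoc_left_right[of "oe b" "oe a" x] * by (simp add: om L algebra_simps)
  then show "R b (R a x) = - R a (R b x)"
    by (simp only: eq_neg_iff_add_eq_0)
qed

lemma L_anticommute:
  assumes "1 \<le> a" "a < 8" "1 \<le> b" "b < 8" "a \<noteq> b"
  shows "L b (L a x) = - L a (L b x)"
proof -
  obtain c where "(a, b, c) \<in> oct_triples \<or> (b, a, c) \<in> oct_triples"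
    using oct_triples_exhaust assms by blast
  then show ?thesis using triple_relations(3)[of a b c x] triple_relations(3)[of b a c x] by auto
qed

text \<open>
  With $N = 1 + L_a L_b L_c$ and $N' = 1 - R_a R_b R_c$, the bimodule axioms say
  $[R_a, L_b] = N L_c = -N' R_c$ and cyclically. Applying $N$ to this commutator yields $N = N'$.
\<close>

lemma triple_opposite:
  assumes abc: "(a, b, c) \<in> oct_triples"
  shows "R a x + L a (L b (L c (R a x))) = - (L a x + L a (L b (L c (L a x))))"
proof -
  note bca = oct_triples_cyclic[OF abc]
  note cab = oct_triples_cyclic[OF bca]
  note rels = triple_relations[OF abc] triple_relations[OF bca] triple_relations[OF cab]
  note ranges = oct_triples_range[OF abc]
  have sq: "L a (L a x) = - x" "L b (L b x) = - x" "L c (L c x) = - x"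
    "R a (R a x) = - x" "R b (R b x) = - x" "R c (R c x) = - x" for x
    using L_square R_square ranges by auto
  have ac: "L b (L a x) = - L a (L b x)" "L c (L b x) = - L b (L c x)" "L c (L a x) = - L a (L c x)"
    "R b (R a x) = - R a (R b x)" "R c (R b x) = - R b (R c x)" "R c (R a x) = - R a (R c x)" for x
    using rels(3,4,7,8,11,12) by (simp_all add: minus_equation_iff)
  define N where "N x = x + L a (L b (L c x))" for x
  define N' where "N' x = x - R a (R b (R c x))" for x
  have Nlin: "N (- x) = - N x" "N (x - y) = N x - N y" "N' (- x) = - N' x" "N' (x - y) = N' x - N' y" for x y
    by (simp_all add: N_def N'_def)
  \<comment> \<open>Each of \<open>L a\<close>, \<open>L b\<close>, \<open>L c\<close> anticommutes
    with exactly two of the three factors in \<open>N\<close>, hence commutes with their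
    product.\<close>
  have NL: "N (L a x) = L a (N x)" "N (L b x) = L b (N x)" "N (L c x) = L c (N x)" for x
    by (simp_all add: N_def sq ac)
  have NR': "N' (R a x) = R a (N' x)" "N' (R b x) = R b (N' x)" "N' (R c x) = R c (N' x)" for x
    by (simp_all add: N'_def sq ac)
  have comm: "R a (L b x) - L b (R a x) = N (L c x)" for x
    using rels(1) by (simp add: N_def sq ac)
  have N_L: "N (L a x) = - N' (R a x)" "N (L b x) = - N' (R b x)" "N (L c x) = - N' (R c x)" for x
  proof -
    have "N (L a x) = L a x - L b (L c x)" "N (L b x) = L b x + L a (L c x)" "N (L c x) = L c x - L a (L b x)"
      "N' (R a x) = R b (R c x) + R a x" "N' (R b x) = R b x - R a (R c x)" "N' (R c x) = R a (R b x) + R c x"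
      by (simp_all add: N_def N'_def sq ac add.commute)
    then show "N (L a x) = - N' (R a x)" "N (L b x) = - N' (R b x)" "N (L c x) = - N' (R c x)"
      using rels(2)[of x] rels(6)[of x] rels(10)[of x] by (simp_all add: ac)
  qed
  \<comment> \<open>Put \<open>R a x\<close> for \<open>x\<close> in \<open>N_L\<close>: applying
    \<open>R a\<close> twice gives \<open>-1\<close>, and \<open>N\<close> commutes with
    \<open>L a\<close>.\<close>
  have N'1: "N' x = L a (N (R a x))" "N' x = L b (N (R b x))" for x
    using N_L(1)[of "R a x"] N_L(2)[of "R b x"] by (simp_all add: NL sq Nlin)
  have NR: "N (R a x) = - L a (N' x)" "N (R b x) = - L b (N' x)" for x
    using N'1(1)[of x] by (simp add: sq, subst N'1(2), simp add: sq)
  have N'L: "N' (L a x) = L a (N' x)" "N' (L b x) = L b (N' x)" for x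
    using N'1(1)[of "L a x"] N'1(2)[of "L b x"] L_R_same NL N'1 by metis+
  \<comment> \<open>The product of \<open>L a\<close>, \<open>L b\<close>, \<open>L c\<close>
    squares to the identity, so \<open>N\<close> is twice a projection.\<close>
  have NN: "N (N x) = N x + N x" for x
    by (simp add: N_def sq ac)
  have "L a (L b (N' x)) = L a (L b (N x))" for x
  proof -
    have "N (R a (L b x) - L b (R a x)) = N (L c x) + N (L c x)"
      by (simp only: comm NN)
    moreover have "N (R a (L b x) - L b (R a x)) = - (L a (L b (N' x)) + L a (L b (N' x)))"
      by (simp add: Nlin NL NR N'L ac)
    moreover have "N (L c x) = - L a (L b (N x))"
      by (simp add: N_def sq ac)
    ultimately have "2 *\<^sub>R (L a (L b (N' x))) = 2 *\<^sub>R (L a (L b (N x)))"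
      unfolding scaleR_2 by (simp add: neg_eq_iff_add_eq_0 algebra_simps)
    then show ?thesis by simp
  qed
  then have "N' x = N x" for x
    by (metis sq(1,2) minus_equation_iff)
  then have "N (R a x) = - N (L a x)"
    using NR NL by simp
  then show ?thesis by (simp add: N_def)
qed

text \<open>Used as rewrite rules, these bring every word in the \<open>L i\<close> to a signed
  increasing word without repetition.\<close>

lemma L_words:
  shows "L 1 (L 1 x) = - x"
    "L 2 (L 2 x) = - x"
    "L 3 (L 3 x) = - x"
    "L 4 (L 4 x) = - x"
    "L 5 (L 5 x) = - x"
    "L 6 (L 6 x) = - x"
    "L 7 (L 7 x) = - x"
    "L 2 (L 1 x) = - L 1 (L 2 x)" "L 3 (L 1 x) = - L 1 (L 3 x)" "L 4 (L 1 x) = - L 1 (L 4 x)" "L 5 (L 1 x) = - L 1 (L 5 x)" "L 6 (L 1 x) = - L 1 (L 6 x)" "L 7 (L 1 x) = - L 1 (L 7 x)"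
    "L 3 (L 2 x) = - L 2 (L 3 x)" "L 4 (L 2 x) = - L 2 (L 4 x)" "L 5 (L 2 x) = - L 2 (L 5 x)" "L 6 (L 2 x) = - L 2 (L 6 x)" "L 7 (L 2 x) = - L 2 (L 7 x)"
    "L 4 (L 3 x) = - L 3 (L 4 x)" "L 5 (L 3 x) = - L 3 (L 5 x)" "L 6 (L 3 x) = - L 3 (L 6 x)" "L 7 (L 3 x) = - L 3 (L 7 x)"
    "L 5 (L 4 x) = - L 4 (L 5 x)" "L 6 (L 4 x) = - L 4 (L 6 x)" "L 7 (L 4 x) = - L 4 (L 7 x)"
    "L 6 (L 5 x) = - L 5 (L 6 x)" "L 7 (L 5 x) = - L 5 (L 7 x)"
    "L 7 (L 6 x) = - L 6 (L 7 x)"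
  by ((rule L_square L_anticommute; simp)+)

text \<open>
  Let $\Omega$ be the product of the three involutions on the lines through $e_1$. On the image of
  $G = \Omega + 1$ the operator $R_1$ is $-L_1$, and then $[R_1, L_2] = L_4 - L_1 L_2$ makes
  $T = L_1 L_2 L_4$ the identity there; but $L_3$ preserves this image and anticommutes with $T$.
\<close>

lemma volume_element: "L 1 (L 2 (L 3 (L 4 (L 5 (L 6 (L 7 x)))))) = - x"
proof -
  define T where "T a b c x = L a (L b (L c x))" for a b c x
  define G where "G x = T 1 2 4 (T 1 5 6 (T 1 3 7 x)) + x" for x
  have Glin: "G (x - y) = G x - G y" "G (x + y) = G x + G y" "G (- x) = - G x" for x y
    by (simp_all add: G_def T_def)
  \<comment> \<open>Up to sign, the word in \<open>G\<close> is the product of all seven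
    \<open>L i\<close>; as their number is odd, it commutes with each of them.\<close>
  have GL: "G (L 1 x) = L 1 (G x)" "G (L 2 x) = L 2 (G x)" "G (L 4 x) = L 4 (G x)" for x
    by (simp_all add: G_def T_def L_words)
  have GR: "G (R 1 x) = - L 1 (G x)" for x
  proof -
    have T: "T 1 b c (R 1 x + L 1 x) = - (R 1 x + L 1 x)" if "(1, b, c) \<in> oct_triples" for b c
    proof -
      have "T 1 b c (R 1 x + L 1 x) + (R 1 x + L 1 x) = 0"
        using triple_opposite[OF that, of x] by (simp add: T_def eq_neg_iff_add_eq_0 algebra_simps)
      then show ?thesis by (simp only: eq_neg_iff_add_eq_0)
    qed
    have Tneg: "T a b c (- y) = - T a b c y" for a b c y
      by (simp add: T_def)
    have "T 1 2 4 (T 1 5 6 (T 1 3 7 (R 1 x + L 1 x))) = - (R 1 x + L 1 x)"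
      by (simp only: T Tneg oct_triples_def insert_iff simp_thms minus_minus)
    then have "G (R 1 x - - L 1 x) = 0"
      by (simp add: G_def)
    then show ?thesis by (simp add: Glin GL eq_neg_iff_add_eq_0)
  qed
  have fix_T: "T 1 2 4 (G x) = G x" for x
  proof -
    have "R 1 (L 2 y) - L 2 (R 1 y) = L 4 y - L 1 (L 2 y)" for y
      by (rule triple_relations) (simp add: oct_triples_def)
    then have "G (R 1 (L 2 y) - L 2 (R 1 y)) = G (L 4 y - L 1 (L 2 y))" for y
      by simp
    then have "L 4 (G y) = - L 1 (L 2 (G y))" for y
      by (simp add: Glin GL GR L_words)
    from this[of "L 4 x"] show ?thesis
      by (simp add: T_def GL L_words)
  qed
  have G3: "G (L 3 x) = L 3 (G x)" for x
    by (simp add: G_def T_def L_words)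
  have "T 1 2 4 (L 3 (G x)) = L 3 (G x)"
    using fix_T[of "L 3 x"] by (simp only: G3)
  moreover have "T 1 2 4 (L 3 (G x)) = - L 3 (T 1 2 4 (G x))"
    by (simp add: T_def L_words)
  ultimately have "L 3 (G x) + L 3 (G x) = 0"
    using fix_T[of x] by (metis add.right_inverse)
  then have "2 *\<^sub>R L 3 (G x) = 0"
    by (simp only: scaleR_2)
  then have "L 3 (L 3 (G x)) = 0"
    by simp
  then have "G x = 0"
    by (simp add: L_words)
  \<comment> \<open>Sorting the nine factors in \<open>G\<close> leaves \<open>L 1\<close> to
    \<open>L 7\<close> in order, with sign plus.\<close>
  then show ?thesis
    by (simp add: G_def T_def L_words eq_neg_iff_add_eq_0)
qed

text \<open>By \<open>volume_element\<close>, the word on the complement of a line is, up to sign,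
  the word on the line. Two lines without their common point form the complement of the third line
  through it, so products of two line involutions reduce to a third.\<close>

lemma L_words_complement:
  shows "L 3 (L 5 (L 6 (L 7 x))) = L 1 (L 2 (L 4 x))"
    and "L 1 (L 4 (L 6 (L 7 x))) = - L 2 (L 3 (L 5 x))"
    and "L 1 (L 2 (L 5 (L 7 x))) = L 3 (L 4 (L 6 x))"
    and "L 1 (L 2 (L 3 (L 6 x))) = - L 4 (L 5 (L 7 x))"
    and "L 2 (L 3 (L 4 (L 7 x))) = - L 1 (L 5 (L 6 x))"
    and "L 1 (L 3 (L 4 (L 5 x))) = L 2 (L 6 (L 7 x))"
    and "L 2 (L 4 (L 5 (L 6 x))) = L 1 (L 3 (L 7 x))"
proof -
  show "L 3 (L 5 (L 6 (L 7 x))) = L 1 (L 2 (L 4 x))"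
    using volume_element[of "L 1 (L 2 (L 4 x))"] by (simp add: L_words)
  show "L 1 (L 4 (L 6 (L 7 x))) = - L 2 (L 3 (L 5 x))"
    using volume_element[of "L 2 (L 3 (L 5 x))"] by (simp add: L_words)
  show "L 1 (L 2 (L 5 (L 7 x))) = L 3 (L 4 (L 6 x))"
    using volume_element[of "L 3 (L 4 (L 6 x))"] by (simp add: L_words)
  show "L 1 (L 2 (L 3 (L 6 x))) = - L 4 (L 5 (L 7 x))"
    using volume_element[of "L 4 (L 5 (L 7 x))"] by (simp add: L_words)
  show "L 2 (L 3 (L 4 (L 7 x))) = - L 1 (L 5 (L 6 x))"
    using volume_element[of "L 1 (L 5 (L 6 x))"] by (simp add: L_words)
  show "L 1 (L 3 (L 4 (L 5 x))) = L 2 (L 6 (L 7 x))"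
    using volume_element[of "L 2 (L 6 (L 7 x))"] by (simp add: L_words)
  show "L 2 (L 4 (L 5 (L 6 x))) = L 1 (L 3 (L 7 x))"
    using volume_element[of "L 1 (L 3 (L 7 x))"] by (simp add: L_words)
qed

subsection \<open>The projection onto the real part\<close>

text \<open>Eight times the average over the group consisting of the identity and the seven $-L_a L_b L_c$.\<close>

definition real_proj8 :: "'m \<Rightarrow> 'm" where
  "real_proj8 x = x - L 1 (L 2 (L 4 x)) - L 2 (L 3 (L 5 x)) - L 3 (L 4 (L 6 x)) - L 4 (L 5 (L 7 x)) - L 5 (L 6 (L 1 x)) - L 6 (L 7 (L 2 x)) - L 7 (L 1 (L 3 x))"

definition real_proj :: "'m \<Rightarrow> 'm" where
  "real_proj x = (1/8) *\<^sub>R real_proj8 x"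

lemma linear_real_proj: "linear real_proj"
  by (rule linearI) (simp_all add: real_proj_def real_proj8_def algebra_simps)

text \<open>The negative of this product lies in the group averaged over, so multiplying by it on
  either side permutes the eight terms.\<close>

lemma triple_real_proj8:
  assumes "(a, b, c) \<in> oct_triples"
  shows "L a (L b (L c (real_proj8 x))) = - real_proj8 x"
    and "real_proj8 (L a (L b (L c x))) = - real_proj8 x"
  using assms unfolding oct_triples_def
  by (elim insertE emptyE; simp add: real_proj8_def L_words L_words_complement)+

lemma triple_real_proj:
  assumes "(a, b, c) \<in> oct_triples"
  shows "L a (L b (L c (real_proj x))) = - real_proj x"
    and "real_proj (L a (L b (L c x))) = - real_proj x"
  by (simp_all add: real_proj_def triple_real_proj8[OF assms])

text \<open>The sign undoes \<open>L i (L i x) = - x\<close>, so that \<open>coord i\<close>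
  recovers a real \<open>m\<close> from \<open>L i m\<close>.\<close>

definition coord :: "nat \<Rightarrow> 'm \<Rightarrow> 'm" where
  "coord i x = (if i = 0 then real_proj x else - real_proj (L i x))"

text \<open>For \<open>i > 0\<close>, conjugation by \<open>L i\<close> keeps the terms of lines
  through \<open>i\<close> and negates those of the other lines. Each line thus occurs four times
  with either sign and cancels, while the identity occurs eight times.\<close>

lemma sum_coord: "x = (\<Sum>i<8. L i (coord i x))"
proof -
  have "8 *\<^sub>R x = (1+1+1+1+1+1+1+1) *\<^sub>R x"
    by simp
  also have "\<dots> = x+x+x+x+x+x+x+x"
    by (simp only: scaleR_add_left scaleR_one)
  also have "\<dots> = (\<Sum>i<8. L i (if i = 0 then real_proj8 x else - real_proj8 (L i x)))"
    by (simp add: lessThan_8 real_proj8_def L_words L_words_complement)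
  also have "\<dots> = 8 *\<^sub>R (\<Sum>i<8. L i (coord i x))"
    unfolding scaleR_sum_right by (intro sum.cong refl) (simp add: coord_def real_proj_def)
  finally show ?thesis by simp
qed

text \<open>
  If all associators with $m$ vanish, then $[x,y,mz] = [mz,x,y] = m[z,x,y]$ and $[x,y,mz] = [x,ym,z] = [z,x,ym] = [z,x,y]m$.
\<close>

lemma nuclear_commute:
  assumes nuc: "\<And>p q. lm (omul p q) m = lm p (lm q m)"
  shows "lm p m = rm m p"
proof -
  have mid: "rm (lm q m) p = lm q (rm m p)" for p q
    using assoc_left_middle[of p q m] by (simp add: nuc)
  have right: "rm (rm m p) q = rm m (omul p q)" for p q
    using assoc_left_right[of p q m] by (simp add: nuc)
  have assoc: "lm (oassoc z x y) m = rm m (oassoc z x y)" for x y z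
  proof -
    have "lm (omul x y) (rm m z) - lm x (lm y (rm m z)) = rm m (oassoc z x y)"
      using assoc_left_right[of x y "rm m z"] by (simp add: right oassoc_def)
    moreover have "lm (oassoc z x y) m = rm (lm x (lm y m)) z - lm x (rm (lm y m) z)"
      using assoc_left_middle[of z x "lm y m"] by (simp add: oassoc_def flip: nuc)
    moreover have "\<dots> = lm (omul x y) (rm m z) - lm x (lm y (rm m z))"
      by (simp add: mid flip: nuc)
    ultimately show ?thesis by simp
  qed
  show ?thesis
  proof (rule oct_eqI[OF linear_lm_left linear_rm_right])
    fix i :: nat
    assume "i < 8"
    show "L i m = R i m"
    proof (cases "i = 0")
      case False
      then obtain x y z where "oassoc x y z = -2 *\<^sub>R oe i"
        using oassoc_basis[of i] \<open>i < 8\<close> by auto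
      with assoc[of x y z] show ?thesis by simp
    qed simp
  qed
qed

section \<open>Values of the projection, and its vanishing on associators\<close>

lemma ReM_iff: "m \<in> oct_ReM lm rm \<longleftrightarrow> (\<forall>p q. lm (omul p q) m = lm p (lm q m))"
  unfolding oct_ReM_def mem_Collect_eq right_minus_eq using nuclear_commute by blast

lemma linear_simps_real_proj [simp]:
  "real_proj (x + y) = real_proj x + real_proj y" "real_proj (x - y) = real_proj x - real_proj y"
  "real_proj (- x) = - real_proj x" "real_proj (r *\<^sub>R x) = r *\<^sub>R real_proj x" "real_proj 0 = 0"
  using linear_real_proj by (simp_all add: linear_add linear_diff linear_neg linear_scale linear_0)

lemma linear_lm_omul: "linear (\<lambda>p. lm (omul p q) x)" "linear (\<lambda>q. lm (omul p q) x)"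
  using linear_compose[OF linear_omul_left linear_lm_left] linear_compose[OF linear_omul_right linear_lm_left]
  by (simp_all add: comp_def)

lemma linear_lm_lm: "linear (\<lambda>p. lm p (lm q x))" "linear (\<lambda>q. lm p (lm q x))"
  using linear_lm_left linear_compose[OF linear_lm_left linear_lm] by (simp_all add: comp_def)

text \<open>Both follow from \<open>triple_real_proj\<close> by cancelling one factor
  \<open>L c\<close>, whose square is \<open>-1\<close>.\<close>

lemma L_L_real_proj:
  assumes "(a, b, c) \<in> oct_triples"
  shows "L a (L b (real_proj x)) = L c (real_proj x)"
    and "real_proj (L a (L b x)) = real_proj (L c x)"
proof -
  note bca = oct_triples_cyclic[OF assms]
  note r = oct_triples_range[OF assms]
  have "L c (L c (L a (L b (real_proj x)))) = - L a (L b (real_proj x))"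
    using r by (simp add: L_square)
  moreover have "L c (L a (L b (real_proj x))) = - real_proj x"
    using triple_real_proj(1)[OF oct_triples_cyclic[OF bca]] by simp
  ultimately show "L a (L b (real_proj x)) = L c (real_proj x)"
    by simp
  show "real_proj (L a (L b x)) = real_proj (L c x)"
    using triple_real_proj(2)[OF assms, of "L c x"] r by (simp add: L_square)
qed

lemma real_proj_mem: "real_proj x \<in> oct_ReM lm rm"
proof -
  have "lm (omul p q) (real_proj x) = lm p (lm q (real_proj x))" for p q
  proof (rule oct_bilinear_eqI[OF linear_lm_omul linear_lm_lm])
    fix i j :: nat
    assume ij: "i < 8" "j < 8"
    show "lm (omul (oe i) (oe j)) (real_proj x) = L i (L j (real_proj x))"
      using ij by (cases rule: oct_basis_cases[OF ij])
        (auto simp: omul_oe_self L_square omul_oe_triple L_L_real_proj triple_relations(3))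
  qed
  then show ?thesis by (simp add: ReM_iff)
qed

text \<open>This is how the projection kills associators; on distinct imaginary units it rests on
  the second half of \<open>L_L_real_proj\<close>.\<close>

lemma real_proj_assoc_left: "real_proj (lm (omul p q) x) = real_proj (lm p (lm q x))"
proof (rule oct_bilinear_eqI)
  fix i j :: nat
  assume ij: "i < 8" "j < 8"
  show "real_proj (lm (omul (oe i) (oe j)) x) = real_proj (L i (L j x))"
    using ij by (cases rule: oct_basis_cases[OF ij])
      (auto simp: omul_oe_self L_square omul_oe_triple L_L_real_proj triple_relations(3))
qed (simp_all add: linear_iff linear_add[OF linear_omul_left] linear_add[OF linear_omul_right]
    linear_scale[OF linear_omul_left] linear_scale[OF linear_omul_right])

lemma real_proj_assoc_right: "real_proj (rm (rm x p) q) = real_proj (rm x (omul p q))"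
  using arg_cong[OF assoc_left_right[of p q x], of real_proj] by (simp add: real_proj_assoc_left)

section \<open>Calculation with real elements and uniqueness of the decomposition\<close>

lemma ReM_lm_lm: "m \<in> oct_ReM lm rm \<Longrightarrow> lm p (lm q m) = lm (omul p q) m"
  by (simp add: ReM_iff)

lemma ReM_commute: "m \<in> oct_ReM lm rm \<Longrightarrow> lm p m = rm m p"
  by (simp add: oct_ReM_def)

lemma ReM_rm_rm: "m \<in> oct_ReM lm rm \<Longrightarrow> rm (rm m p) q = rm m (omul p q)"
  using assoc_left_right[of p q m] by (simp add: ReM_lm_lm)

lemma ReM_rm_lm: "m \<in> oct_ReM lm rm \<Longrightarrow> rm (lm p m) q = lm (omul p q) m"
  by (simp add: ReM_commute ReM_rm_rm)

lemma ReM_triple: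
  assumes "m \<in> oct_ReM lm rm" "(a, b, c) \<in> oct_triples"
  shows "L a (L b (L c m)) = - m"
  using assms oct_triples_range[OF assms(2)] omul_oe_triple[OF oct_triples_cyclic[OF assms(2)]]
  by (simp add: ReM_lm_lm omul_oe_self)

lemma real_proj_ReM:
  assumes "m \<in> oct_ReM lm rm"
  shows "real_proj m = m"
proof -
  have "real_proj8 m = m+m+m+m+m+m+m+m"
    unfolding real_proj8_def using ReM_triple[OF assms] by (simp add: oct_triples_def)
  also have "\<dots> = (1+1+1+1+1+1+1+1) *\<^sub>R m"
    by (simp only: scaleR_add_left scaleR_one)
  finally show ?thesis by (simp add: real_proj_def)
qed

text \<open>For a line missing \<open>i\<close>, \<open>L i\<close> anticommutes with all three
  factors, so their product fixes \<open>L i m\<close>; but \<open>real_proj\<close> changes sign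
  under that product.\<close>

lemma real_proj_L_ReM:
  assumes m: "m \<in> oct_ReM lm rm" and i: "1 \<le> i" "i < 8"
  shows "real_proj (L i m) = 0"
proof -
  have "\<exists>a b c. (a, b, c) \<in> oct_triples \<and> i \<notin> {a, b, c}"
  proof -
    have "(1, 2, 4) \<in> oct_triples" "(3, 4, 6) \<in> oct_triples" "(7, 1, 3) \<in> oct_triples"
      by (simp_all add: oct_triples_def)
    moreover have "i \<notin> {1, 2, 4} \<or> i \<notin> {3, 4, 6} \<or> i \<notin> {7, 1, 3}"
      by auto
    ultimately show ?thesis by blast
  qed
  then obtain a b c where abc: "(a, b, c) \<in> oct_triples" and ni: "i \<notin> {a, b, c}" by blast
  have ac: "L a (L i x) = - L i (L a x)" "L b (L i x) = - L i (L b x)" "L c (L i x) = - L i (L c x)" for x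
    using oct_triples_range[OF abc] ni i by (auto intro!: L_anticommute)
  have "L a (L b (L c (L i m))) = L i m"
    by (simp add: ac ReM_triple[OF m abc])
  then have "real_proj (L i m) = - real_proj (L i m)"
    using triple_real_proj(2)[OF abc, of "L i m"] by simp
  then have "2 *\<^sub>R real_proj (L i m) = 0"
    unfolding scaleR_2 by (metis add.right_inverse)
  then show ?thesis by simp
qed

lemma real_proj_sum:
  assumes "\<And>i. i < 8 \<Longrightarrow> m i \<in> oct_ReM lm rm"
  shows "real_proj (\<Sum>i<8. L i (m i)) = m 0"
proof -
  have "real_proj (\<Sum>i<8. L i (m i)) = (\<Sum>i<8. real_proj (L i (m i)))"
    by (rule linear_sum[OF linear_real_proj])
  also have "\<dots> = (\<Sum>i<8::nat. if i = 0 then m 0 else 0)"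
    by (intro sum.cong refl) (simp add: assms real_proj_ReM real_proj_L_ReM)
  finally show ?thesis by simp
qed

lemma ReM_uminus: "m \<in> oct_ReM lm rm \<Longrightarrow> - m \<in> oct_ReM lm rm"
  by (simp add: ReM_iff)

lemma coord_mem: "coord i x \<in> oct_ReM lm rm"
  by (simp add: coord_def real_proj_mem ReM_uminus)

text \<open>Existence is \<open>sum_coord\<close>; uniqueness holds because \<open>real_proj\<close>
  reads off the component at \<open>0\<close> of any decomposition.\<close>

lemma oct_Re_eq: "oct_Re lm rm x = real_proj x"
  unfolding oct_Re_def
proof (rule the_equality)
  show "\<exists>xs. (\<forall>i<8. xs i \<in> oct_ReM lm rm) \<and> x = (\<Sum>i<8. L i (xs i)) \<and> real_proj x = xs 0"
    using sum_coord coord_mem by (intro exI[of _ "\<lambda>i. coord i x"]) (simp add: coord_def)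
qed (use real_proj_sum in auto)

text \<open>Testing with \<open>q = e_j\<close> isolates \<open>coord j y\<close> up to sign,
  because \<open>e_i e_j\<close> has a real component only for \<open>i = j\<close>.\<close>

lemma eq_0_if_real_proj_rm:
  assumes "\<And>q. real_proj (rm y q) = 0"
  shows "y = 0"
proof -
  have "coord j y = 0" if j: "j < 8" for j
  proof -
    \<comment> \<open>The sign in \<open>e_j e_j = s e_0\<close>.\<close>
    define s where "s = (if j = 0 then 1 else -1 :: real)"
    have "0 = real_proj (rm (\<Sum>i<8. L i (coord i y)) (oe j))"
      using assms sum_coord[of y] by simp
    also have "\<dots> = (\<Sum>i<8. real_proj (lm (omul (oe i) (oe j)) (coord i y)))"
      by (simp add: bilinear_sum linear_sum[OF linear_real_proj] ReM_rm_lm coord_mem)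
    also have "\<dots> = (\<Sum>i<8. if i = j then s *\<^sub>R coord j y else 0)"
    proof (intro sum.cong refl)
      fix i :: nat
      assume "i \<in> {..<8}"
      then have ij: "i < 8" "j < 8" using j by simp_all
      then show "real_proj (lm (omul (oe i) (oe j)) (coord i y)) = (if i = j then s *\<^sub>R coord j y else 0)"
        by (cases rule: oct_basis_cases[OF ij])
          (auto simp: s_def omul_oe_self omul_oe_triple real_proj_ReM real_proj_L_ReM coord_mem
            dest: oct_triples_range)
    qed
    also have "\<dots> = s *\<^sub>R coord j y"
      using j by simp
    finally show ?thesis by (simp add: s_def split: if_splits)
  qed
  then show ?thesis
    using sum_coord[of y] by simp
qed

lemma ReM_subset_CJM: "oct_ReM lm rm \<subseteq> oct_CJM lm rm J"
proof
  fix x assume "x \<in> oct_ReM lm rm"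
  moreover have "x = x + lm J 0" by simp
  moreover have "0 \<in> oct_ReM lm rm" by (simp add: ReM_iff)
  ultimately show "x \<in> oct_CJM lm rm J" unfolding oct_CJM_def by blast
qed

text \<open>As \<open>p\<close> is a combination of \<open>1\<close> and \<open>J\<close>, right
  alternativity suffices, although \<open>x\<close> is arbitrary.\<close>

lemma rm_rm_CJ:
  assumes "p \<in> oct_CJ J"
  shows "rm (rm x J) p = rm x (omul J p)"
proof -
  have "omul J (oe 0) = J"
    using oct_eqI[of "\<lambda>p. omul p (oe 0)" "\<lambda>p. p"] linear_omul_left linear_id by (simp add: id_def)
  then show ?thesis
    using assms linear_omul_right[of J]
    by (auto simp: oct_CJ_def linear_add linear_scale assoc_right_self)
qed

end

section \<open>Para-linear maps\<close>

theorem mainTheorem20: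
  fixes lm :: "oct \<Rightarrow> 'm::real_vector \<Rightarrow> 'm" and rm :: "'m \<Rightarrow> oct \<Rightarrow> 'm"
    and lm' :: "oct \<Rightarrow> 'n::real_vector \<Rightarrow> 'n" and rm' :: "'n \<Rightarrow> oct \<Rightarrow> 'n"
    and f :: "'m \<Rightarrow> 'n"
  assumes "oct_bimodule lm rm" and "oct_bimodule lm' rm'" and "linear f"
  shows "(right_para_linear rm lm' rm' f
            \<longleftrightarrow> (\<forall>p x. x \<in> oct_ReM lm rm \<longrightarrow> oct_B rm rm' f p x = 0))
       \<and> ((\<forall>p x. x \<in> oct_ReM lm rm \<longrightarrow> oct_B rm rm' f p x = 0)
            \<longleftrightarrow> (\<forall>J\<in>oct_S. \<forall>p\<in>oct_CJ J. \<forall>z\<in>oct_CJM lm rm J. oct_B rm rm' f p z = 0))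
       \<and> ((\<forall>J\<in>oct_S. \<forall>p\<in>oct_CJ J. \<forall>z\<in>oct_CJM lm rm J. oct_B rm rm' f p z = 0)
            \<longleftrightarrow> (\<forall>J\<in>oct_S. \<forall>p\<in>oct_CJ J. \<forall>z\<in>oct_CJM lm rm J. f (rm z p) = rm' (f z) p))"
proof -
  interpret M: octonion_bimodule lm rm by unfold_locales fact
  interpret N: octonion_bimodule lm' rm' by unfold_locales fact
  note f = linear_add[OF \<open>linear f\<close>] linear_diff[OF \<open>linear f\<close>] linear_sum[OF \<open>linear f\<close>] linear_scale[OF \<open>linear f\<close>]
  have para: "right_para_linear rm lm' rm' f \<longleftrightarrow> (\<forall>p x. N.real_proj (oct_B rm rm' f p x) = 0)"
    by (simp add: right_para_linear_def N.oct_Re_eq)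
  have linear_B: "linear (\<lambda>p. oct_B rm rm' f p x)" for x
    by (rule linearI) (simp_all add: oct_B_def f algebra_simps)
  have real_of_para: "oct_B rm rm' f p x = 0"
    if "\<forall>p x. N.real_proj (oct_B rm rm' f p x) = 0" and x: "x \<in> oct_ReM lm rm" for p x
  proof (rule N.eq_0_if_real_proj_rm)
    fix q
    have eq: "N.real_proj (f (rm y r)) = N.real_proj (rm' (f y) r)" for y r
      using that(1) by (simp add: oct_B_def)
    \<comment> \<open>Under the real part \<open>f\<close> commutes with right multiplication, and
      \<open>(xp)q = x(pq)\<close> for real \<open>x\<close>. The term \<open>(f(x)p)q\<close> has
      the same real part, since associators have real part zero.\<close>
    have "N.real_proj (rm' (f (rm x p)) q) = N.real_proj (rm' (f x) (omul p q))"
      by (simp add: M.ReM_rm_rm[OF x] flip: eq)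
    then show "N.real_proj (rm' (oct_B rm rm' f p x) q) = 0"
      by (simp add: oct_B_def N.real_proj_assoc_right)
  qed
  have para_of_real: "N.real_proj (oct_B rm rm' f p x) = 0"
    if "\<forall>p x. x \<in> oct_ReM lm rm \<longrightarrow> oct_B rm rm' f p x = 0" for p x
  proof -
    have eq: "f (rm y r) = rm' (f y) r" if "y \<in> oct_ReM lm rm" for y r
      using that \<open>\<forall>p x. _ \<longrightarrow> _\<close> by (simp add: oct_B_def)
    let ?y = "\<lambda>i. M.coord i x"
    have "x = (\<Sum>i<8. rm (?y i) (oe i))"
      using M.sum_coord[of x] by (simp add: M.ReM_commute M.coord_mem)
    moreover have "N.real_proj (oct_B rm rm' f p (\<Sum>i<8. rm (?y i) (oe i))) = 0"
      by (simp add: oct_B_def M.bilinear_sum N.bilinear_sum f eq M.coord_mem M.ReM_rm_rm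
          linear_sum[OF N.linear_real_proj] N.real_proj_assoc_right)
    ultimately show ?thesis by simp
  qed
  have CJ_of_real: "oct_B rm rm' f p z = 0"
    if "\<forall>p x. x \<in> oct_ReM lm rm \<longrightarrow> oct_B rm rm' f p x = 0"
      and p: "p \<in> oct_CJ J" and z: "z \<in> oct_CJM lm rm J" for J p z
  proof -
    have eq: "f (rm y r) = rm' (f y) r" if "y \<in> oct_ReM lm rm" for y r
      using that \<open>\<forall>p x. _ \<longrightarrow> _\<close> by (simp add: oct_B_def)
    obtain a b where "z = a + lm J b" "a \<in> oct_ReM lm rm" "b \<in> oct_ReM lm rm"
      using z by (auto simp: oct_CJM_def)
    \<comment> \<open>On the second summand,
      \<open>f((bJ)p) = f(b(Jp)) = f(b)(Jp) = (f(b)J)p\<close>; the outer equalities are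
      \<open>rm_rm_CJ\<close> in the two bimodules.\<close>
    then show ?thesis
      by (simp add: oct_B_def f M.ReM_commute M.rm_rm_CJ[OF p] N.rm_rm_CJ[OF p] eq)
  qed
  have real_of_CJ: "oct_B rm rm' f p x = 0"
    if CJ: "\<forall>J\<in>oct_S. \<forall>p\<in>oct_CJ J. \<forall>z\<in>oct_CJM lm rm J. oct_B rm rm' f p z = 0"
      and x: "x \<in> oct_ReM lm rm" for p x
  proof (rule oct_eqI[OF linear_B linear_zero])
    fix i :: nat
    assume "i < 8"
    show "oct_B rm rm' f (oe i) x = 0"
    proof (cases "i = 0")
      case True
      then show ?thesis by (simp add: oct_B_def)
    next
      case False
      then have "oe i \<in> oct_S" using oe_mem_S \<open>i < 8\<close> by simp
      moreover have "oe i = 0 *\<^sub>R oe 0 + 1 *\<^sub>R oe i" by simp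
      then have "oe i \<in> oct_CJ (oe i)" unfolding oct_CJ_def by blast
      ultimately show ?thesis
        using CJ x M.ReM_subset_CJM by blast
    qed
  qed
  have zero_iff: "oct_B rm rm' f p z = 0 \<longleftrightarrow> f (rm z p) = rm' (f z) p" for p z
    by (auto simp: oct_B_def)
  show ?thesis
  proof (intro conjI)
    show "right_para_linear rm lm' rm' f \<longleftrightarrow> (\<forall>p x. x \<in> oct_ReM lm rm \<longrightarrow> oct_B rm rm' f p x = 0)"
      unfolding para using real_of_para para_of_real by blast
    show "(\<forall>p x. x \<in> oct_ReM lm rm \<longrightarrow> oct_B rm rm' f p x = 0)
        \<longleftrightarrow> (\<forall>J\<in>oct_S. \<forall>p\<in>oct_CJ J. \<forall>z\<in>oct_CJM lm rm J. oct_B rm rm' f p z = 0)"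
      using CJ_of_real real_of_CJ by blast
  qed (simp only: zero_iff)
qed

end
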